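(* Let $(\mathfrak g,J,g)$ be a four dimensional Kähler Lie algebra. Assume that there exists an abelian ideal $\mathfrak h\subset\mathfrak g$ such that there is a splitting short exact sequence of Lie algebras $$0\longrightarrow \mathfrak h\longrightarrow \mathfrak g\longrightarrow J\mathfrak h\longrightarrow 0,$$ where the sum is orthogonal; that is, $J\mathfrak h$ is a subalgebra, $\mathfrak g=\mathfrak h\oplus J\mathfrak h$ as a vector space, and $\mathfrak h$ and $J\mathfrak h$ are orthogonal with respect to $g$. Then $\mathfrak g$ is isomorphic to one of the Lie algebras $\mathbb R^4$, $\mathbb R\times\mathfrak h_3$, $\mathbb R^2\times\mathfrak{aff}(\mathbb R)$, $\mathfrak{aff}(\mathbb C)$, $\mathfrak{aff}(\mathbb R)\times\mathfrak{aff}(\mathbb R)$, $\mathfrak r_{4,-1,-1}$, $\mathfrak d_{4,1}$, $\mathfrak d_{4,2}$, $\mathfrak d_{4,1/2}$.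
   Context: All Lie algebras are real and finite dimensional. A complex structure on $\mathfrak g$ is an endomorphism $J$ with $J^2=-I$ and $[Jx,Jy]-[x,y]-J[Jx,y]-J[x,Jy]=0$ for all $x,y$. A symplectic structure is a closed nondegenerate 2-form $\omega$ on $\mathfrak g$ (closed: $\omega([x,y],z)+\omega([y,z],x)+\omega([z,x],y)=0$). A Kähler Lie algebra is a Lie algebra with a complex structure $J$ and a symplectic structure $\omega$ with $\omega(Jx,Jy)=\omega(x,y)$; the associated pseudo-Kähler metric is $g(x,y)=\omega(Jx,y)$ (not necessarily definite), and one writes $(\mathfrak g,J,g)$. The Lie algebras, in a basis $e_1,\dots,e_4$ with the nonzero brackets: $\mathbb R\times\mathfrak h_3$: $[e_1,e_2]=e_3$. $\mathbb R^2\times\mathfrak{aff}(\mathbb R)$: $[e_1,e_2]=e_2$. $\mathfrak{aff}(\mathbb R)\times\mathfrak{aff}(\mathbb R)$: $[e_1,e_2]=e_2$, $[e_3,e_4]=e_4$. $\mathfrak{aff}(\mathbb C)$ (as a real Lie algebra): $[e_1,e_3]=e_3$, $[e_1,e_4]=e_4$, $[e_2,e_3]=e_4$, $[e_2,e_4]=-e_3$. $\mathfrak r_{4,-1,-1}$: $[e_4,e_1]=e_1$, $[e_4,e_2]=-e_2$, $[e_4,e_3]=-e_3$. $\mathfrak d_{4,\lambda}$: $[e_1,e_2]=e_3$, $[e_4,e_3]=e_3$, $[e_4,e_1]=\lambda e_1$, $[e_4,e_2]=(1-\lambda)e_2$. $\mathbb R^4$ is abelian. *)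

theory Defs
  imports "HOL-Analysis.Analysis"
begin

section \<open>Real Lie algebras\<close>

definition lie_bracket :: "('a::real_vector \<Rightarrow> 'a \<Rightarrow> 'a) \<Rightarrow> bool" where
  "lie_bracket br \<longleftrightarrow> bilinear br \<and> (\<forall>x. br x x = 0) \<and>
     (\<forall>x y z. br x (br y z) + br y (br z x) + br z (br x y) = 0)"

definition lie_isomorphic ::
  "('a::real_vector \<Rightarrow> 'a \<Rightarrow> 'a) \<Rightarrow> ('b::real_vector \<Rightarrow> 'b \<Rightarrow> 'b) \<Rightarrow> bool" where
  "lie_isomorphic br br' \<longleftrightarrow>
     (\<exists>f. linear f \<and> bij f \<and> (\<forall>x y. f (br x y) = br' (f x) (f y)))"

definition lie_subalgebra :: "('a::real_vector \<Rightarrow> 'a \<Rightarrow> 'a) \<Rightarrow> 'a set \<Rightarrow> bool" where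
  "lie_subalgebra br S \<longleftrightarrow> subspace S \<and> (\<forall>x\<in>S. \<forall>y\<in>S. br x y \<in> S)"

definition lie_ideal :: "('a::real_vector \<Rightarrow> 'a \<Rightarrow> 'a) \<Rightarrow> 'a set \<Rightarrow> bool" where
  "lie_ideal br I \<longleftrightarrow> subspace I \<and> (\<forall>x. \<forall>y\<in>I. br x y \<in> I)"

definition lie_abelian_on :: "('a::real_vector \<Rightarrow> 'a \<Rightarrow> 'a) \<Rightarrow> 'a set \<Rightarrow> bool" where
  "lie_abelian_on br S \<longleftrightarrow> (\<forall>x\<in>S. \<forall>y\<in>S. br x y = 0)"


section \<open>Kaehler Lie algebras\<close>

definition complex_structure ::
  "('a::real_vector \<Rightarrow> 'a \<Rightarrow> 'a) \<Rightarrow> ('a \<Rightarrow> 'a) \<Rightarrow> bool" where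
  "complex_structure br J \<longleftrightarrow> linear J \<and> (\<forall>x. J (J x) = - x) \<and>
     (\<forall>x y. br (J x) (J y) - br x y - J (br (J x) y) - J (br x (J y)) = 0)"

definition symplectic_structure ::
  "('a::real_vector \<Rightarrow> 'a \<Rightarrow> 'a) \<Rightarrow> ('a \<Rightarrow> 'a \<Rightarrow> real) \<Rightarrow> bool" where
  "symplectic_structure br \<omega> \<longleftrightarrow> bilinear \<omega> \<and> (\<forall>x. \<omega> x x = 0) \<and>
     (\<forall>x. (\<forall>y. \<omega> x y = 0) \<longrightarrow> x = 0) \<and>
     (\<forall>x y z. \<omega> (br x y) z + \<omega> (br y z) x + \<omega> (br z x) y = 0)"

definition kaehler_lie_algebra ::
  "('a::real_vector \<Rightarrow> 'a \<Rightarrow> 'a) \<Rightarrow> ('a \<Rightarrow> 'a) \<Rightarrow> ('a \<Rightarrow> 'a \<Rightarrow> real) \<Rightarrow> bool" where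
  "kaehler_lie_algebra br J \<omega> \<longleftrightarrow> lie_bracket br \<and> complex_structure br J \<and>
     symplectic_structure br \<omega> \<and> (\<forall>x y. \<omega> (J x) (J y) = \<omega> x y)"

definition pk_metric :: "('a \<Rightarrow> 'a) \<Rightarrow> ('a \<Rightarrow> 'a \<Rightarrow> real) \<Rightarrow> 'a \<Rightarrow> 'a \<Rightarrow> real" where
  "pk_metric J \<omega> x y = \<omega> (J x) y"

text \<open>
  A splitting of \<open>0 \<rightarrow> \<hh> \<rightarrow> \<gg> \<rightarrow> J \<hh> \<rightarrow> 0\<close> means that the subspace \<open>J \<hh>\<close> is a subalgebra
  complementary to the ideal \<open>\<hh>\<close>; that \<open>\<hh>\<close> is an ideal is not part of this definition.
\<close>

definition orthogonal_J_splitting ::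
  "('a::real_vector \<Rightarrow> 'a \<Rightarrow> 'a) \<Rightarrow> ('a \<Rightarrow> 'a) \<Rightarrow> ('a \<Rightarrow> 'a \<Rightarrow> real) \<Rightarrow> 'a set \<Rightarrow> bool" where
  "orthogonal_J_splitting br J g \<hh> \<longleftrightarrow> lie_subalgebra br (J ` \<hh>) \<and>
     \<hh> \<inter> J ` \<hh> = {0} \<and> {x + y | x y. x \<in> \<hh> \<and> y \<in> J ` \<hh>} = UNIV \<and>
     (\<forall>x\<in>\<hh>. \<forall>y\<in>J ` \<hh>. g x y = 0)"


section \<open>The four-dimensional Lie algebras\<close>

text \<open>
  All brackets live on \<^typ>\<open>real^4\<close> with basis \<open>e 1, \<dots>, e 4\<close>. A summand
  \<open>wedge i j x y *\<^sub>R v\<close> contributes \<open>[e i, e j] = v = - [e j, e i]\<close> and vanishes on all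
  other pairs of basis vectors. (In the index type, \<open>4 = 0\<close>; the indices
  \<open>1, 2, 3, 4\<close> are distinct and exhaust it.)
\<close>

abbreviation e :: "4 \<Rightarrow> real^4" where
  "e i \<equiv> axis i 1"

definition wedge :: "4 \<Rightarrow> 4 \<Rightarrow> real^4 \<Rightarrow> real^4 \<Rightarrow> real" where
  "wedge i j x y = x $ i * y $ j - x $ j * y $ i"

definition R4_br :: "real^4 \<Rightarrow> real^4 \<Rightarrow> real^4" where
  "R4_br x y = 0"

definition R_h3_br :: "real^4 \<Rightarrow> real^4 \<Rightarrow> real^4" where
  "R_h3_br x y = wedge 1 2 x y *\<^sub>R e 3"

definition R2_affR_br :: "real^4 \<Rightarrow> real^4 \<Rightarrow> real^4" where
  "R2_affR_br x y = wedge 1 2 x y *\<^sub>R e 2"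

definition affR_affR_br :: "real^4 \<Rightarrow> real^4 \<Rightarrow> real^4" where
  "affR_affR_br x y = wedge 1 2 x y *\<^sub>R e 2 + wedge 3 4 x y *\<^sub>R e 4"

definition affC_br :: "real^4 \<Rightarrow> real^4 \<Rightarrow> real^4" where
  "affC_br x y = wedge 1 3 x y *\<^sub>R e 3 + wedge 1 4 x y *\<^sub>R e 4
     + wedge 2 3 x y *\<^sub>R e 4 + wedge 2 4 x y *\<^sub>R (- e 3)"

definition r4_m1_m1_br :: "real^4 \<Rightarrow> real^4 \<Rightarrow> real^4" where
  "r4_m1_m1_br x y = wedge 4 1 x y *\<^sub>R e 1 + wedge 4 2 x y *\<^sub>R (- e 2)
     + wedge 4 3 x y *\<^sub>R (- e 3)"

definition d4_br :: "real \<Rightarrow> real^4 \<Rightarrow> real^4 \<Rightarrow> real^4" where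
  "d4_br l x y = wedge 1 2 x y *\<^sub>R e 3 + wedge 4 3 x y *\<^sub>R e 3
     + wedge 4 1 x y *\<^sub>R (l *\<^sub>R e 1) + wedge 4 2 x y *\<^sub>R ((1 - l) *\<^sub>R e 2)"

end

theory Submission
  imports Defs
begin

text \<open>
  The splitting turns the classification of four-dimensional Lie algebras into one of
  two-dimensional algebras. On the plane \<open>\<hh>\<close> put the product \<open>x \<star> y = [J x, y]\<close>. Since \<open>\<hh>\<close> is
  abelian, integrability of \<open>J\<close> reads \<open>[J x, J y] = J (x \<star> y - y \<star> x)\<close>; hence \<open>\<star>\<close> determines
  the whole bracket of \<open>\<gg> = \<hh> \<oplus> J \<hh>\<close>, and the Jacobi identity says that \<open>\<star>\<close> is left-symmetric,
  \<open>x \<star> (y \<star> z) - y \<star> (x \<star> z) = (x \<star> y - y \<star> x) \<star> z\<close>. Orthogonality makes \<open>\<hh>\<close> and \<open>J \<hh>\<close>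
  Lagrangian, so \<open>g\<close> is nondegenerate on \<open>\<hh>\<close>, and closedness of \<open>\<omega>\<close> becomes the Hessian
  (Codazzi) condition \<open>g (x \<star> y) z + g y (x \<star> z) = g (y \<star> x) z + g x (y \<star> z)\<close>.

  If \<open>\<star>\<close> is commutative it is associative, and a two-dimensional commutative associative real
  algebra is one of six: the zero algebra, the nilpotent algebra with \<open>u \<star> u = w\<close>, \<open>\<real> \<oplus> 0\<close>, the
  dual numbers, \<open>\<complex>\<close>, or \<open>\<real> \<oplus> \<real>\<close> (\<open>commutative_plane_cases\<close>). They give \<open>\<real>\<^sup>4\<close>, \<open>\<real> \<times> \<hh>\<^sub>3\<close>,
  \<open>\<real>\<^sup>2 \<times> aff(\<real>)\<close>, \<open>\<dd>\<^sub>4\<close> with parameter 1, \<open>aff(\<complex>)\<close> and \<open>aff(\<real>) \<times> aff(\<real>)\<close>.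

  If \<open>\<star>\<close> is not commutative, the commutator is the nonabelian Lie bracket on the plane and there
  is a basis with \<open>w \<star> u - u \<star> w = u\<close>. The left-symmetric products then form families with free
  parameters, and the Hessian metric is what cuts these down to three cases
  (\<open>noncommutative_plane_cases\<close>). They give \<open>\<rr>\<^sub>4\<close> with parameters -1, -1 and \<open>\<dd>\<^sub>4\<close> with
  parameter 2 or 1/2.
\<close>

section \<open>Isomorphisms from bracket tables\<close>

lemmas bilinear_expand =
  bilinear_ladd bilinear_radd bilinear_lsub bilinear_rsub bilinear_lmul bilinear_rmul
  bilinear_lneg bilinear_rneg bilinear_lzero bilinear_rzero

lemma bilinear_alternating_antisym:
  fixes B :: "'a::real_vector \<Rightarrow> 'a \<Rightarrow> 'b::real_vector"
  assumes B: "bilinear B" and alt: "\<And>x. B x x = 0"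
  shows "B y x = - B x y"
proof -
  have "B y x + B x y = 0"
    using alt[of "x + y"] unfolding bilinear_ladd[OF B] bilinear_radd[OF B] by (simp add: alt)
  then show ?thesis
    by (simp add: eq_neg_iff_add_eq_0)
qed

definition frame_map :: "'a::real_vector \<Rightarrow> 'a \<Rightarrow> 'a \<Rightarrow> 'a \<Rightarrow> real^4 \<Rightarrow> 'a" where
  "frame_map v1 v2 v3 v4 x = x$1 *\<^sub>R v1 + x$2 *\<^sub>R v2 + x$3 *\<^sub>R v3 + x$4 *\<^sub>R v4"

lemma linear_frame_map: "linear (frame_map v1 v2 v3 v4)"
  by (rule linearI) (simp_all add: frame_map_def algebra_simps)

lemma frame_map_axis [simp]:
  "frame_map v1 v2 v3 v4 (e 1) = v1" "frame_map v1 v2 v3 v4 (e 2) = v2"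
  "frame_map v1 v2 v3 v4 (e 3) = v3" "frame_map v1 v2 v3 v4 (e 4) = v4"
  by (simp_all add: frame_map_def axis_def)

lemma inj_linear_surj_if_dim_eq:
  fixes f :: "'b::euclidean_space \<Rightarrow> 'a::real_vector"
  assumes lin: "linear f" and inj: "inj f" and dim: "dim (UNIV :: 'a set) = DIM('b)"
  shows "surj f"
proof -
  have ind: "independent (f ` Basis)"
    by (rule linear_independent_injective_image[OF lin])
       (auto simp: independent_Basis intro: inj_on_subset[OF inj])
  have card: "card (f ` Basis) = DIM('b)"
    by (rule card_image) (rule inj_on_subset[OF inj], simp)
  obtain C :: "'a set" where C: "independent C" "UNIV \<subseteq> span C" "card C = DIM('b)"
    using basis_exists[of "UNIV :: 'a set"] dim by metis
  have finC: "finite C"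
    using C(3) by (metis DIM_positive card.infinite less_irrefl)
  have "z \<in> span (f ` Basis)" for z
  proof (rule ccontr)
    assume z: "z \<notin> span (f ` Basis)"
    then have "independent (insert z (f ` Basis))"
      using ind by (rule real_vector.independent_insertI)
    then have "card (insert z (f ` Basis)) \<le> card C"
      using real_vector.independent_span_bound[OF finC, of "insert z (f ` Basis)"] C(2) by blast
    moreover have "z \<notin> f ` Basis"
      using z span_base[of z "f ` Basis"] by auto
    ultimately show False
      using card C(3) by simp
  qed
  then have "span (f ` Basis) = UNIV"
    by blast
  then show ?thesis
    unfolding linear_span_image[OF lin] span_Basis .
qed

text \<open>
  Two alternating bracket operations that agree on the six pairs of frame vectors agree
  everywhere, so the linear coordinate map of the frame is an isomorphism. By the dimension
  hypothesis linear independence is enough to make it bijective.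
\<close>

lemma lie_isomorphic_by_frame:
  fixes br :: "'a::real_vector \<Rightarrow> 'a \<Rightarrow> 'a" and B :: "real^4 \<Rightarrow> real^4 \<Rightarrow> real^4"
  assumes dim: "dim (UNIV :: 'a set) = 4"
    and br: "bilinear br" "\<And>x. br x x = 0"
    and B: "bilinear B" "\<And>x. B x x = 0"
    and indep: "\<And>a b c d. a *\<^sub>R v1 + b *\<^sub>R v2 + c *\<^sub>R v3 + d *\<^sub>R v4 = 0 \<Longrightarrow>
                  a = 0 \<and> b = 0 \<and> c = 0 \<and> d = 0"
    and table:
      "br v1 v2 = frame_map v1 v2 v3 v4 (B (e 1) (e 2))"
      "br v1 v3 = frame_map v1 v2 v3 v4 (B (e 1) (e 3))"
      "br v1 v4 = frame_map v1 v2 v3 v4 (B (e 1) (e 4))"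
      "br v2 v3 = frame_map v1 v2 v3 v4 (B (e 2) (e 3))"
      "br v2 v4 = frame_map v1 v2 v3 v4 (B (e 2) (e 4))"
      "br v3 v4 = frame_map v1 v2 v3 v4 (B (e 3) (e 4))"
  shows "lie_isomorphic br B"
proof -
  let ?F = "frame_map v1 v2 v3 v4"
  note lin = linear_frame_map[of v1 v2 v3 v4]
  have inj: "inj ?F"
    unfolding linear_injective_0[OF lin]
    using indep by (auto simp: frame_map_def vec_eq_iff forall_4)
  have surj: "surj ?F"
    by (rule inj_linear_surj_if_dim_eq[OF lin inj]) (simp add: dim)
  have Fbr: "?F (B x y) = br (?F x) (?F y)" for x y
  proof -
    note asym = bilinear_alternating_antisym[OF br] bilinear_alternating_antisym[OF B]
    have ax: "?F (B (e i) (e j)) = br (?F (e i)) (?F (e j))" for i j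
    proof -
      have "\<forall>i j. ?F (B (e i) (e j)) = br (?F (e i)) (?F (e j))"
        unfolding forall_4 frame_map_axis
        by (simp add: table br(2) B(2) linear_0[OF lin] linear_neg[OF lin]
          asym(1)[of v2 v1] asym(1)[of v3 v1] asym(1)[of v4 v1]
          asym(1)[of v3 v2] asym(1)[of v4 v2] asym(1)[of v4 v3]
          asym(2)[of "e 2" "e 1"] asym(2)[of "e 3" "e 1"] asym(2)[of "e 4" "e 1"]
          asym(2)[of "e 3" "e 2"] asym(2)[of "e 4" "e 2"] asym(2)[of "e 4" "e 3"])
      then show ?thesis by blast
    qed
    have "bilinear (\<lambda>x y. ?F (B x y))" "bilinear (\<lambda>x y. br (?F x) (?F y))"
      using br(1) B(1) lin unfolding bilinear_def
      by (auto intro: linear_compose[unfolded o_def])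
    from bilinear_eq_stdbasis[OF this]
    have "(\<lambda>x y. ?F (B x y)) = (\<lambda>x y. br (?F x) (?F y))"
      using ax by (auto simp: Basis_vec_def)
    then show ?thesis by meson
  qed
  have bij: "bij ?F"
    using inj surj by (simp add: bij_def)
  have F_inv: "?F (inv ?F z) = z" and inv_F: "inv ?F (?F x) = x" for z x
    using inj surj by (simp_all add: surj_f_inv_f)
  have "linear (inv ?F)"
  proof (rule linearI)
    show "inv ?F (x + y) = inv ?F x + inv ?F y" for x y
      using inv_F[of "inv ?F x + inv ?F y"] by (simp add: linear_add[OF lin] F_inv)
    show "inv ?F (c *\<^sub>R x) = c *\<^sub>R inv ?F x" for c x
      using inv_F[of "c *\<^sub>R inv ?F x"] by (simp add: linear_cmul[OF lin] F_inv)
  qed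
  moreover have "bij (inv ?F)"
    using bij by (rule bij_imp_bij_inv)
  moreover have "inv ?F (br x y) = B (inv ?F x) (inv ?F y)" for x y
    using inv_F[of "B (inv ?F x) (inv ?F y)"] by (simp add: Fbr F_inv)
  ultimately show ?thesis
    unfolding lie_isomorphic_def by blast
qed

lemma wedge_linear:
  "wedge i j (x + y) z = wedge i j x z + wedge i j y z"
  "wedge i j z (x + y) = wedge i j z x + wedge i j z y"
  "wedge i j (c *\<^sub>R x) z = c * wedge i j x z"
  "wedge i j z (c *\<^sub>R x) = c * wedge i j z x"
  "wedge i j x x = 0"
  by (simp_all add: wedge_def algebra_simps)

lemmas model_br_defs = R4_br_def R_h3_br_def R2_affR_br_def affC_br_def affR_affR_br_def
  r4_m1_m1_br_def d4_br_def

lemma model_bilinear: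
  "bilinear R4_br" "bilinear R_h3_br" "bilinear R2_affR_br" "bilinear affC_br"
  "bilinear affR_affR_br" "bilinear r4_m1_m1_br" "bilinear (d4_br l)"
  unfolding bilinear_def linear_iff model_br_defs wedge_linear
  by (simp_all add: scaleR_left_distrib scaleR_right_distrib add_ac mult_ac
        scaleR_right_diff_distrib distrib_left)

lemma model_alternating:
  "R4_br x x = 0" "R_h3_br x x = 0" "R2_affR_br x x = 0" "affC_br x x = 0"
  "affR_affR_br x x = 0" "r4_m1_m1_br x x = 0" "d4_br l x x = 0"
  by (simp_all add: model_br_defs wedge_linear)

section \<open>Bases of a plane\<close>

definition plane_basis :: "'a::real_vector set \<Rightarrow> 'a \<Rightarrow> 'a \<Rightarrow> bool" where
  "plane_basis H u w \<longleftrightarrow> u \<in> H \<and> w \<in> H \<and>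
     (\<forall>x\<in>H. \<exists>a b. x = a *\<^sub>R u + b *\<^sub>R w) \<and>
     (\<forall>a b. a *\<^sub>R u + b *\<^sub>R w = 0 \<longrightarrow> a = 0 \<and> b = 0)"

lemma plane_basisD:
  assumes "plane_basis H u w"
  shows "u \<in> H" "w \<in> H"
    "\<And>x. x \<in> H \<Longrightarrow> \<exists>a b. x = a *\<^sub>R u + b *\<^sub>R w"
    "\<And>a b. a *\<^sub>R u + b *\<^sub>R w = 0 \<Longrightarrow> a = 0 \<and> b = 0"
  using assms by (auto simp: plane_basis_def)

lemma plane_basis_coeff_eq:
  assumes "plane_basis H u w" and "a *\<^sub>R u + b *\<^sub>R w = c *\<^sub>R u + d *\<^sub>R w"
  shows "a = c" "b = d"
proof -
  have "(a - c) *\<^sub>R u + (b - d) *\<^sub>R w = 0"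
    using assms(2) by (simp add: algebra_simps)
  then show "a = c" "b = d"
    using plane_basisD(4)[OF assms(1)] by fastforce+
qed

text \<open>
  Cramer's rule: the coordinates of \<open>u\<close> and \<open>w\<close> in the given basis form a matrix whose
  determinant cannot vanish for an independent pair, so the given basis can be expressed in
  terms of \<open>u\<close> and \<open>w\<close>.
\<close>

lemma plane_basisI:
  assumes pq: "plane_basis H p q" and mem: "u \<in> H" "w \<in> H"
    and ind: "\<And>a b. a *\<^sub>R u + b *\<^sub>R w = 0 \<Longrightarrow> a = 0 \<and> b = 0"
  shows "plane_basis H u w"
proof -
  obtain a b c d where u: "u = a *\<^sub>R p + b *\<^sub>R q" and w: "w = c *\<^sub>R p + d *\<^sub>R q"
    using plane_basisD(3)[OF pq] mem by metis
  define D where "D = a * d - b * c"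
  have Dp: "d *\<^sub>R u + (- b) *\<^sub>R w = D *\<^sub>R p" and Dq: "(- c) *\<^sub>R u + a *\<^sub>R w = D *\<^sub>R q"
    by (simp_all add: u w D_def algebra_simps)
  have D: "D \<noteq> 0"
  proof
    assume "D = 0"
    then have "d = 0 \<and> b = 0" "c = 0 \<and> a = 0"
      using Dp Dq ind[of d "-b"] ind[of "-c" a] by auto
    then have "1 *\<^sub>R u + 0 *\<^sub>R w = 0" by (simp add: u)
    then show False using ind by fastforce
  qed
  have "\<exists>a b. x = a *\<^sub>R u + b *\<^sub>R w" if "x \<in> H" for x
  proof -
    obtain s t where x: "x = s *\<^sub>R p + t *\<^sub>R q"
      using plane_basisD(3)[OF pq \<open>x \<in> H\<close>] by metis
    have "D *\<^sub>R x = s *\<^sub>R (D *\<^sub>R p) + t *\<^sub>R (D *\<^sub>R q)"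
      by (simp add: x algebra_simps)
    also have "\<dots> = (s * d - t * c) *\<^sub>R u + (t * a - s * b) *\<^sub>R w"
      unfolding Dp[symmetric] Dq[symmetric] by (simp add: algebra_simps)
    finally have Dx: "D *\<^sub>R x = (s * d - t * c) *\<^sub>R u + (t * a - s * b) *\<^sub>R w" .
    have "x = (1 / D) *\<^sub>R (D *\<^sub>R x)"
      using D by simp
    also have "\<dots> = ((s * d - t * c) / D) *\<^sub>R u + ((t * a - s * b) / D) *\<^sub>R w"
      unfolding Dx by (simp add: scaleR_right_distrib)
    finally show ?thesis by blast
  qed
  then show ?thesis
    unfolding plane_basis_def using mem ind by blast
qed

lemma plane_basis_change:
  assumes xy: "plane_basis H x y" and H: "subspace H" and det: "a * d - b * c \<noteq> 0"
  shows "plane_basis H (a *\<^sub>R x + b *\<^sub>R y) (c *\<^sub>R x + d *\<^sub>R y)"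
proof (rule plane_basisI[OF xy])
  note mem = plane_basisD(1,2)[OF xy]
  show "a *\<^sub>R x + b *\<^sub>R y \<in> H" "c *\<^sub>R x + d *\<^sub>R y \<in> H"
    using mem H by (simp_all add: subspace_add subspace_scale)
  show "s = 0 \<and> t = 0"
    if st: "s *\<^sub>R (a *\<^sub>R x + b *\<^sub>R y) + t *\<^sub>R (c *\<^sub>R x + d *\<^sub>R y) = 0" for s t
  proof -
    have "(s * a + t * c) *\<^sub>R x + (s * b + t * d) *\<^sub>R y = 0"
      using st by (simp add: algebra_simps)
    then have "s * a + t * c = 0" "s * b + t * d = 0"
      using plane_basisD(4)[OF xy] by blast+
    then have "(a * d - b * c) * s = 0" "(a * d - b * c) * t = 0"
      by algebra+
    then show ?thesis using det by simp
  qed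
qed

text \<open>
  As an introduction rule this reduces an identity between products expanded in a basis to
  identities of real numbers.
\<close>

lemma lincomb_cong: "a = c \<Longrightarrow> b = d \<Longrightarrow> a *\<^sub>R x + b *\<^sub>R y = c *\<^sub>R x + d *\<^sub>R y"
  by simp

section \<open>Left-symmetric products on a plane\<close>

locale left_symmetric_plane =
  fixes H :: "'a::real_vector set"
    and mult :: "'a \<Rightarrow> 'a \<Rightarrow> 'a" (infixl "\<star>" 70)
  assumes subspace: "subspace H"
    and bilin: "bilinear (\<star>)"
    and closed: "\<And>x y. x \<in> H \<Longrightarrow> y \<in> H \<Longrightarrow> x \<star> y \<in> H"
    and left_sym: "\<And>x y z. x \<in> H \<Longrightarrow> y \<in> H \<Longrightarrow> z \<in> H \<Longrightarrow>
      x \<star> (y \<star> z) - y \<star> (x \<star> z) = (x \<star> y - y \<star> x) \<star> z"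
    and two_dim: "\<exists>p q. plane_basis H p q"
begin

lemmas mult_expand = bilinear_expand[OF bilin]

definition mult_table :: "'a \<Rightarrow> 'a \<Rightarrow> 'a \<Rightarrow> 'a \<Rightarrow> 'a \<Rightarrow> 'a \<Rightarrow> bool" where
  "mult_table u w uu uw wu ww \<longleftrightarrow> u \<star> u = uu \<and> u \<star> w = uw \<and> w \<star> u = wu \<and> w \<star> w = ww"

lemma mult_lincomb:
  assumes "mult_table x y (a1 *\<^sub>R x + b1 *\<^sub>R y) (a2 *\<^sub>R x + b2 *\<^sub>R y)
             (a3 *\<^sub>R x + b3 *\<^sub>R y) (a4 *\<^sub>R x + b4 *\<^sub>R y)"
  shows "(a *\<^sub>R x + b *\<^sub>R y) \<star> (c *\<^sub>R x + d *\<^sub>R y) =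
     (a * c * a1 + a * d * a2 + b * c * a3 + b * d * a4) *\<^sub>R x +
     (a * c * b1 + a * d * b2 + b * c * b3 + b * d * b4) *\<^sub>R y"
  using assms by (simp add: mult_table_def mult_expand algebra_simps)

text \<open>
  Completing the square replaces \<open>x\<close> by an element \<open>f\<close> with \<open>f \<star> f = \<delta> i\<close>, where \<open>i\<close> is the unit
  and \<open>4 \<delta>\<close> is the discriminant of \<open>t\<^sup>2 - q t - p\<close>. Its sign separates the dual numbers, the complex
  numbers and \<open>\<real> \<oplus> \<real>\<close>.
\<close>

lemma unital_plane_cases:
  assumes basis: "plane_basis H i x"
    and table: "mult_table i x i x x (p *\<^sub>R i + q *\<^sub>R x)"
  shows "\<exists>u w. plane_basis H u w \<and>
    (mult_table u w u w w 0 \<or> mult_table u w u w w (- u) \<or> mult_table u w u 0 0 w)"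
proof -
  define f where "f = (- q / 2) *\<^sub>R i + 1 *\<^sub>R x"
  define \<delta> where "\<delta> = p + q\<^sup>2 / 4"
  have basis_f: "plane_basis H i f"
    using plane_basis_change[OF basis subspace, of 1 1 0 "- q / 2"] by (simp add: f_def)
  have prods: "i \<star> i = i" "i \<star> x = x" "x \<star> i = x" "x \<star> x = p *\<^sub>R i + q *\<^sub>R x"
    using table by (auto simp: mult_table_def)
  have T: "mult_table i x (1 *\<^sub>R i + 0 *\<^sub>R x) (0 *\<^sub>R i + 1 *\<^sub>R x)
      (0 *\<^sub>R i + 1 *\<^sub>R x) (p *\<^sub>R i + q *\<^sub>R x)"
    using table by simp
  have "f \<star> f = \<delta> *\<^sub>R i + 0 *\<^sub>R x"
    unfolding f_def mult_lincomb[OF T]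
    by (rule lincomb_cong) (simp_all add: \<delta>_def power2_eq_square)
  then have ff: "f \<star> f = \<delta> *\<^sub>R i" by simp
  have if_f: "i \<star> f = f" "f \<star> i = f"
    by (simp_all add: f_def mult_expand prods)
  consider "\<delta> = 0" | "\<delta> < 0" | "\<delta> > 0" by linarith
  then show ?thesis
  proof cases
    case 1
    then have "mult_table i f i f f 0"
      by (simp add: mult_table_def prods if_f ff)
    then show ?thesis using basis_f by blast
  next
    case 2
    define w where "w = (1 / sqrt (- \<delta>)) *\<^sub>R f"
    have "plane_basis H i w"
      using plane_basis_change[OF basis_f subspace, of 1 "1 / sqrt (- \<delta>)" 0 0] 2
      by (simp add: w_def)
    moreover have "w \<star> w = (1 / sqrt (- \<delta>) * (1 / sqrt (- \<delta>)) * \<delta>) *\<^sub>R i"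
      by (simp add: w_def mult_expand ff)
    then have "w \<star> w = - i"
      using 2 by simp
    then have "mult_table i w i w w (- i)"
      by (simp add: mult_table_def prods if_f w_def mult_expand)
    ultimately show ?thesis by blast
  next
    case 3
    define s where "s = 1 / (2 * sqrt \<delta>)"
    have s2: "s * s * \<delta> = 1 / 4" and s0: "s \<noteq> 0"
      using 3 by (simp_all add: s_def field_simps)
    \<comment> \<open>The element \<open>2 s f\<close> squares to the unit, so these are complementary idempotents.\<close>
    define u where "u = (1 / 2) *\<^sub>R i + s *\<^sub>R f"
    define w where "w = (1 / 2) *\<^sub>R i + (- s) *\<^sub>R f"
    have "plane_basis H u w"
      unfolding u_def w_def using s0 by (intro plane_basis_change[OF basis_f subspace]) simp
    moreover have T: "mult_table i f (1 *\<^sub>R i + 0 *\<^sub>R f) (0 *\<^sub>R i + 1 *\<^sub>R f)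
        (0 *\<^sub>R i + 1 *\<^sub>R f) (\<delta> *\<^sub>R i + 0 *\<^sub>R f)"
      by (simp add: mult_table_def prods if_f ff)
    have "mult_table u w u 0 0 w"
      using s2 unfolding mult_table_def u_def w_def mult_lincomb[OF T] by simp
    ultimately show ?thesis by blast
  qed
qed

text \<open>
  For a commutative product left symmetry is associativity. If some \<open>x\<close> is independent of its
  square, the algebra is the ideal \<open>(t)\<close> of \<open>\<real>[t]\<close> modulo a cubic \<open>t\<^sup>3 - q t\<^sup>2 - p t\<close>, with \<open>x\<close>
  the class of \<open>t\<close>, and everything depends on \<open>p\<close> and \<open>q\<close>: it has a unit exactly if \<open>p \<noteq> 0\<close>. If instead every
  square is proportional to its root, polarization determines \<open>k \<star> l\<close> in terms of the squares
  of the basis vectors, and associativity forces these squares to vanish.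
\<close>

lemma commutative_plane_cases:
  assumes comm: "\<And>x y. x \<in> H \<Longrightarrow> y \<in> H \<Longrightarrow> x \<star> y = y \<star> x"
  shows "\<exists>u w. plane_basis H u w \<and>
    (mult_table u w 0 0 0 0 \<or> mult_table u w w 0 0 0 \<or> mult_table u w u 0 0 0 \<or>
     mult_table u w u w w 0 \<or> mult_table u w u w w (- u) \<or> mult_table u w u 0 0 w)"
proof -
  have assoc: "x \<star> (y \<star> z) = y \<star> (x \<star> z)" if "x \<in> H" "y \<in> H" "z \<in> H" for x y z
    using left_sym[OF that] comm[OF that(1,2)] by (simp add: mult_expand)
  obtain k l where kl: "plane_basis H k l"
    using two_dim by blast
  show ?thesis
  proof (cases "\<exists>x\<in>H. \<forall>a b. a *\<^sub>R x + b *\<^sub>R (x \<star> x) = 0 \<longrightarrow> a = 0 \<and> b = 0")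
    case True
    then obtain x where xH: "x \<in> H"
      and ind: "\<And>a b. a *\<^sub>R x + b *\<^sub>R (x \<star> x) = 0 \<Longrightarrow> a = 0 \<and> b = 0"
      by blast
    define y where "y = x \<star> x"
    have yH: "y \<in> H"
      unfolding y_def by (rule closed[OF xH xH])
    have basis: "plane_basis H x y"
      using plane_basisI[OF kl xH yH] ind unfolding y_def by blast
    obtain p q where xy: "x \<star> y = p *\<^sub>R x + q *\<^sub>R y"
      using plane_basisD(3)[OF basis closed[OF xH yH]] by blast
    have yx: "y \<star> x = p *\<^sub>R x + q *\<^sub>R y"
      using comm[OF xH yH] xy by simp
    have "y \<star> y = x \<star> (y \<star> x)"
      using assoc[OF yH xH xH] by (simp add: y_def)
    also have "\<dots> = (p * q) *\<^sub>R x + (p + q * q) *\<^sub>R y"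
      by (simp add: yx xy mult_expand y_def[symmetric] algebra_simps)
    finally have yy: "y \<star> y = (p * q) *\<^sub>R x + (p + q * q) *\<^sub>R y" .
    have T: "mult_table x y (0 *\<^sub>R x + 1 *\<^sub>R y) (p *\<^sub>R x + q *\<^sub>R y) (p *\<^sub>R x + q *\<^sub>R y)
        ((p * q) *\<^sub>R x + (p + q * q) *\<^sub>R y)"
      by (simp add: mult_table_def xy yx yy y_def[symmetric])
    consider "p = 0" "q = 0" | "p = 0" "q \<noteq> 0" | "p \<noteq> 0" by blast
    then show ?thesis
    proof cases
      case 1
      then have "mult_table x y y 0 0 0"
        using T by (simp add: mult_table_def)
      then show ?thesis using basis by blast
    next
      case 2
      \<comment> \<open>Here \<open>x \<star> y = q y\<close>, so a multiple of \<open>y\<close> is idempotent, and \<open>x - y / q\<close> annihilates \<open>y\<close>.\<close>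
      define u where "u = 0 *\<^sub>R x + (1 / q\<^sup>2) *\<^sub>R y"
      define w where "w = 1 *\<^sub>R x + (- 1 / q) *\<^sub>R y"
      have "plane_basis H u w"
        unfolding u_def w_def using 2 by (intro plane_basis_change[OF basis subspace]) simp
      moreover have "mult_table u w u 0 0 0"
        unfolding mult_table_def u_def w_def mult_lincomb[OF T]
        using 2 by (simp add: field_simps power2_eq_square)
      ultimately show ?thesis by blast
    next
      case 3
      \<comment> \<open>Dividing \<open>t\<^sup>2 - q t = p\<close> by \<open>p\<close> displays the unit.\<close>
      define i where "i = (- q / p) *\<^sub>R x + (1 / p) *\<^sub>R y"
      have "plane_basis H i (1 *\<^sub>R x + 0 *\<^sub>R y)"
        unfolding i_def using 3 by (intro plane_basis_change[OF basis subspace]) simp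
      then have basis_i: "plane_basis H i x" by simp
      have ix: "i \<star> x = x"
        using mult_lincomb[OF T, of "- q / p" "1 / p" 1 0] 3 by (simp add: i_def)
      have iy: "i \<star> y = y"
        using mult_lincomb[OF T, of "- q / p" "1 / p" 0 1] 3 by (simp add: i_def field_simps)
      have iH: "i \<in> H"
        using plane_basisD(1)[OF basis_i] .
      have ii: "i \<star> i = i"
        by (subst (2) i_def) (simp add: mult_expand ix iy, simp add: i_def)
      have "x \<star> x = p *\<^sub>R i + q *\<^sub>R x"
        using 3 by (simp add: i_def y_def[symmetric] algebra_simps)
      then have "mult_table i x i x x (p *\<^sub>R i + q *\<^sub>R x)"
        using ix ii comm[OF xH iH] by (simp add: mult_table_def)
      then show ?thesis
        using unital_plane_cases[OF basis_i] by blast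
    qed
  next
    case False
    have square: "\<exists>c. x \<star> x = c *\<^sub>R x" if x: "x \<in> H" for x
    proof (cases "x = 0")
      case True
      then show ?thesis by (simp add: mult_expand)
    next
      case nz: False
      obtain a b where ab: "a *\<^sub>R x + b *\<^sub>R (x \<star> x) = 0" "\<not> (a = 0 \<and> b = 0)"
        using False x by blast
      have b: "b \<noteq> 0" using ab nz by auto
      have "b *\<^sub>R (x \<star> x) = (- a) *\<^sub>R x"
        using ab(1) by (simp add: add_eq_0_iff)
      then have "(1 / b) *\<^sub>R (b *\<^sub>R (x \<star> x)) = (1 / b) *\<^sub>R ((- a) *\<^sub>R x)"
        by simp
      then have "x \<star> x = (- a / b) *\<^sub>R x"
        using b by simp
      then show ?thesis by blast
    qed
    note mem = plane_basisD(1,2)[OF kl]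
    have "k + l \<in> H" "k - l \<in> H"
      using mem subspace by (simp_all add: subspace_add subspace_diff)
    then obtain \<rho> \<mu> \<nu> \<kappa> where sq: "k \<star> k = \<rho> *\<^sub>R k" "l \<star> l = \<mu> *\<^sub>R l"
      "(k + l) \<star> (k + l) = \<nu> *\<^sub>R (k + l)" "(k - l) \<star> (k - l) = \<kappa> *\<^sub>R (k - l)"
      using square mem by metis
    have lk: "l \<star> k = k \<star> l" using comm mem by blast
    have plus: "\<rho> *\<^sub>R k + \<mu> *\<^sub>R l + 2 *\<^sub>R (k \<star> l) = \<nu> *\<^sub>R (k + l)"
      unfolding sq(3)[symmetric] by (simp add: mult_expand sq(1,2) lk scaleR_2)
    have minus: "\<rho> *\<^sub>R k + \<mu> *\<^sub>R l - 2 *\<^sub>R (k \<star> l) = \<kappa> *\<^sub>R (k - l)"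
      unfolding sq(4)[symmetric] by (simp add: mult_expand sq(1,2) lk scaleR_2)
    have double: "2 *\<^sub>R X = (X + Y) + (X - Y)" for X Y :: 'a
      by (simp add: scaleR_2)
    have "(2 * \<rho>) *\<^sub>R k + (2 * \<mu>) *\<^sub>R l = 2 *\<^sub>R (\<rho> *\<^sub>R k + \<mu> *\<^sub>R l)"
      by (simp only: scaleR_right_distrib scaleR_scaleR)
    also have "\<dots> = (\<rho> *\<^sub>R k + \<mu> *\<^sub>R l + 2 *\<^sub>R (k \<star> l)) + (\<rho> *\<^sub>R k + \<mu> *\<^sub>R l - 2 *\<^sub>R (k \<star> l))"
      by (rule double)
    also have "\<dots> = (\<nu> + \<kappa>) *\<^sub>R k + (\<nu> - \<kappa>) *\<^sub>R l"
      unfolding plus minus by (simp add: algebra_simps)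
    finally have "2 * \<rho> = \<nu> + \<kappa>" "2 * \<mu> = \<nu> - \<kappa>"
      using plane_basis_coeff_eq[OF kl] by blast+
    then have \<nu>: "\<nu> = \<rho> + \<mu>" by linarith
    have "2 *\<^sub>R (k \<star> l) = \<mu> *\<^sub>R k + \<rho> *\<^sub>R l"
      using plus by (simp add: \<nu> algebra_simps)
    then have "(1 / 2) *\<^sub>R (2 *\<^sub>R (k \<star> l)) = (1 / 2) *\<^sub>R (\<mu> *\<^sub>R k + \<rho> *\<^sub>R l)"
      by simp
    then have prod: "k \<star> l = (\<mu> / 2) *\<^sub>R k + (\<rho> / 2) *\<^sub>R l"
      by (simp add: scaleR_right_distrib)
    have "(\<mu> / 2 * \<rho> + \<rho> / 2 * (\<mu> / 2)) *\<^sub>R k + (\<rho> / 2 * (\<rho> / 2)) *\<^sub>R l = k \<star> (k \<star> l)"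
      by (simp only: prod mult_expand sq(1) scaleR_right_distrib scaleR_left_distrib
          scaleR_scaleR add.assoc)
    also have "\<dots> = l \<star> (k \<star> k)"
      using assoc[OF mem(1) mem(2) mem(1)] lk by simp
    also have "\<dots> = (\<rho> * (\<mu> / 2)) *\<^sub>R k + (\<rho> * (\<rho> / 2)) *\<^sub>R l"
      by (simp only: prod mult_expand sq(1) lk scaleR_right_distrib scaleR_scaleR)
    finally
    have "\<rho> / 2 * (\<rho> / 2) = \<rho> * (\<rho> / 2)"
      by (rule plane_basis_coeff_eq(2)[OF kl])
    then have \<rho>: "\<rho> = 0" by simp
    have "l \<star> (l \<star> k) = k \<star> (l \<star> l)"
      using assoc[OF mem(2) mem(1) mem(2)] lk by simp
    then have "(\<mu> / 2 * (\<mu> / 2)) *\<^sub>R k + 0 *\<^sub>R l = (\<mu> * (\<mu> / 2)) *\<^sub>R k + 0 *\<^sub>R l"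
      by (simp add: mult_expand lk sq(2) prod \<rho>)
    then have "\<mu> / 2 * (\<mu> / 2) = \<mu> * (\<mu> / 2)"
      by (rule plane_basis_coeff_eq(1)[OF kl])
    then have \<mu>: "\<mu> = 0" by simp
    have "mult_table k l 0 0 0 0"
      by (simp add: mult_table_def sq(1,2) lk prod \<rho> \<mu>)
    then show ?thesis using kl by blast
  qed
qed

text \<open>
  The commutator is an alternating map on a plane, so all its values are multiples of a single
  vector \<open>u\<close>; any vector off the line of \<open>u\<close> can be scaled to a \<open>w\<close> with the required commutator.
\<close>

lemma commutator_basis:
  assumes noncomm: "x \<in> H" "y \<in> H" "x \<star> y \<noteq> y \<star> x"
  shows "\<exists>u w. plane_basis H u w \<and> w \<star> u - u \<star> w = u"
proof -
  obtain p q where pq: "plane_basis H p q"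
    using two_dim by blast
  note mem = plane_basisD(1,2)[OF pq]
  define u where "u = p \<star> q - q \<star> p"
  have comm: "(a *\<^sub>R p + b *\<^sub>R q) \<star> (c *\<^sub>R p + d *\<^sub>R q) - (c *\<^sub>R p + d *\<^sub>R q) \<star> (a *\<^sub>R p + b *\<^sub>R q)
      = (a * d - b * c) *\<^sub>R u" for a b c d
    by (simp add: u_def mult_expand algebra_simps)
  have u0: "u \<noteq> 0"
  proof
    assume "u = 0"
    obtain a b c d where "x = a *\<^sub>R p + b *\<^sub>R q" "y = c *\<^sub>R p + d *\<^sub>R q"
      using plane_basisD(3)[OF pq] noncomm(1,2) by metis
    then show False
      using comm[of a b c d] \<open>u = 0\<close> noncomm(3) by simp
  qed
  have uH: "u \<in> H"
    unfolding u_def using closed mem subspace by (simp add: subspace_diff)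
  obtain a b where ab: "u = a *\<^sub>R p + b *\<^sub>R q"
    using plane_basisD(3)[OF pq uH] by blast
  obtain c d where cd: "c * b - d * a = 1"
  proof (cases "a = 0")
    case True
    then have "b \<noteq> 0" using u0 ab by auto
    then show ?thesis using that[of "1 / b" 0] by simp
  next
    case False
    then show ?thesis using that[of 0 "- 1 / a"] by simp
  qed
  define w where "w = c *\<^sub>R p + d *\<^sub>R q"
  have "a * d - b * c \<noteq> 0"
    using cd by (auto simp: algebra_simps)
  then have "plane_basis H u w"
    unfolding ab w_def by (rule plane_basis_change[OF pq subspace])
  moreover have "w \<star> u - u \<star> w = u"
    using comm[of c d a b] cd by (simp add: ab[symmetric] w_def[symmetric])
  ultimately show ?thesis by blast
qed

text \<open>
  In such a basis left symmetry is the single matrix equation \<open>[L w, L u] = L u\<close> for the left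
  multiplications; these are its four entries.
\<close>

lemma left_sym_coeffs:
  assumes basis: "plane_basis H u w" and comm: "w \<star> u - u \<star> w = u"
    and uu: "u \<star> u = a *\<^sub>R u + b *\<^sub>R w"
    and uw: "u \<star> w = c *\<^sub>R u + d *\<^sub>R w"
    and ww: "w \<star> w = p *\<^sub>R u + q *\<^sub>R w"
  shows "b * p - d * c = a" "a * d + b * q - (c + 1) * b - d * d = b"
    "c * (c + 1) + d * p - p * a - q * c = c" "c * d - p * b = d"
proof -
  note mem = plane_basisD(1,2)[OF basis]
  have wu: "w \<star> u = (c + 1) *\<^sub>R u + d *\<^sub>R w"
    using comm uw by (simp add: algebra_simps)
  have rel: "w \<star> (u \<star> z) - u \<star> (w \<star> z) = u \<star> z" if "z \<in> H" for z
    using left_sym[OF mem(2,1) that] comm by simp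
  have "(b * p - d * c) *\<^sub>R u + (a * d + b * q - (c + 1) * b - d * d) *\<^sub>R w
      = w \<star> (u \<star> u) - u \<star> (w \<star> u)"
    unfolding uu wu mult_expand uw ww by (simp add: algebra_simps)
  also have "\<dots> = a *\<^sub>R u + b *\<^sub>R w"
    using rel[OF mem(1)] uu by simp
  finally show "b * p - d * c = a" "a * d + b * q - (c + 1) * b - d * d = b"
    using plane_basis_coeff_eq[OF basis] by blast+
  have "(c * (c + 1) + d * p - p * a - q * c) *\<^sub>R u + (c * d - p * b) *\<^sub>R w
      = w \<star> (u \<star> w) - u \<star> (w \<star> w)"
    unfolding ww uw mult_expand uu wu ww by (simp add: algebra_simps uw)
  also have "\<dots> = c *\<^sub>R u + d *\<^sub>R w"
    using rel[OF mem(2)] uw by simp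
  finally show "c * (c + 1) + d * p - p * a - q * c = c" "c * d - p * b = d"
    using plane_basis_coeff_eq[OF basis] by blast+
qed

text \<open>
  If \<open>u \<star> u\<close> is not a multiple of \<open>u\<close>, shearing \<open>w\<close> makes \<open>u \<star> u\<close> a multiple of \<open>w\<close>, and left
  symmetry fixes the remaining coefficients. Otherwise left symmetry gives \<open>u \<star> u = 0\<close> and
  \<open>u \<star> w = c u\<close> with \<open>c = 0\<close> or \<open>w \<star> w\<close> congruent to \<open>c w\<close> modulo \<open>u\<close>. The Hessian identity,
  evaluated on the basis, then determines the last free eigenvalue, as \<open>g u\<close> cannot vanish on
  the plane; a shear of \<open>w\<close> removes the \<open>u\<close>-component of \<open>w \<star> w\<close>.
\<close>

lemma noncommutative_plane_cases:
  fixes g :: "'a \<Rightarrow> 'a \<Rightarrow> real"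
  assumes noncomm: "\<exists>x\<in>H. \<exists>y\<in>H. x \<star> y \<noteq> y \<star> x"
    and g: "bilinear g" and g_sym: "\<And>x y. x \<in> H \<Longrightarrow> y \<in> H \<Longrightarrow> g x y = g y x"
    and hessian: "\<And>x y z. x \<in> H \<Longrightarrow> y \<in> H \<Longrightarrow> z \<in> H \<Longrightarrow>
        g (x \<star> y) z + g y (x \<star> z) = g (y \<star> x) z + g x (y \<star> z)"
    and nondeg: "\<And>x. x \<in> H \<Longrightarrow> (\<And>y. y \<in> H \<Longrightarrow> g x y = 0) \<Longrightarrow> x = 0"
  shows "\<exists>u w b. plane_basis H u w \<and>
    (mult_table u w 0 0 u (- w) \<or> mult_table u w 0 (-2 *\<^sub>R u) (- u) (-2 *\<^sub>R w) \<or>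
     b \<noteq> 0 \<and> mult_table u w (b *\<^sub>R w) 0 u (2 *\<^sub>R w))"
proof -
  note g_expand = bilinear_expand[OF g]
  obtain u w where basis: "plane_basis H u w" and comm: "w \<star> u - u \<star> w = u"
    using noncomm commutator_basis by blast
  note mem = plane_basisD(1,2)[OF basis]
  obtain a b c d p q where uu: "u \<star> u = a *\<^sub>R u + b *\<^sub>R w"
    and uw: "u \<star> w = c *\<^sub>R u + d *\<^sub>R w" and ww: "w \<star> w = p *\<^sub>R u + q *\<^sub>R w"
    using plane_basisD(3)[OF basis] closed mem by metis
  have wu: "w \<star> u = (c + 1) *\<^sub>R u + d *\<^sub>R w"
    using comm uw by (simp add: algebra_simps)
  note coeffs = left_sym_coeffs[OF basis comm uu uw ww]
  show ?thesis
  proof (cases "b = 0")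
    case False
    \<comment> \<open>Chosen so that \<open>u \<star> u = b v\<close>; the commutator with \<open>u\<close> does not change.\<close>
    define v where "v = (a / b) *\<^sub>R u + 1 *\<^sub>R w"
    have basis_v: "plane_basis H u v"
      using plane_basis_change[OF basis subspace, of 1 1 0 "a / b"] by (simp add: v_def)
    have comm_v: "v \<star> u - u \<star> v = u"
      using comm by (simp add: v_def mult_expand algebra_simps)
    have uu_v: "u \<star> u = 0 *\<^sub>R u + b *\<^sub>R v"
      using False by (simp add: uu v_def scaleR_right_distrib)
    obtain c' d' p' q' where uv: "u \<star> v = c' *\<^sub>R u + d' *\<^sub>R v"
      and vv: "v \<star> v = p' *\<^sub>R u + q' *\<^sub>R v"
      using plane_basisD(3)[OF basis_v] closed plane_basisD(1,2)[OF basis_v] by metis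
    note co = left_sym_coeffs[OF basis_v comm_v uu_v uv vv]
    have d: "d' = 0" using co(1,4) by (simp add: algebra_simps)
    have p: "p' = 0" using co(4) d False by simp
    have "b * (q' - (c' + 2)) = 0" using co(2) d by (simp add: algebra_simps)
    then have q: "q' = c' + 2" using False by simp
    have c: "c' = 0" using co(3) d p q by (simp add: algebra_simps)
    have "v \<star> u = u" using comm_v uv c d by simp
    then have "mult_table u v (b *\<^sub>R v) 0 u (2 *\<^sub>R v)"
      by (simp add: mult_table_def uu_v uv vv c d p q)
    then show ?thesis using basis_v False by blast
  next
    case b: True
    have "a + d = (b * p - d * c) + (c * d - p * b)" using coeffs(1,4) by simp
    then have "d = - a" by (simp add: algebra_simps)
    then have a: "a = 0" using coeffs(2) b \<open>d = - a\<close> by simp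
    then have d: "d = 0" using \<open>d = - a\<close> by simp
    have "c * (c - q) = 0" using coeffs(3) a d by (simp add: algebra_simps)
    then have cq: "c = 0 \<or> q = c" by auto
    note prods = uu[unfolded a b, simplified] uw[unfolded d, simplified]
      wu[unfolded d, simplified] ww
    have T: "mult_table u w (0 *\<^sub>R u + 0 *\<^sub>R w) (c *\<^sub>R u + 0 *\<^sub>R w)
        ((c + 1) *\<^sub>R u + 0 *\<^sub>R w) (p *\<^sub>R u + q *\<^sub>R w)"
      by (simp add: mult_table_def prods)
    have u0: "u \<noteq> 0"
      using plane_basisD(4)[OF basis, of 1 0] by auto
    have g_wu: "g w u = g u w" using g_sym mem by blast
    have hess_u: "c * g u u = 2 * (c + 1) * g u u"
      using hessian[OF mem(1) mem(2) mem(1)] by (simp add: prods g_expand algebra_simps)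
    have hess_w: "2 * c * g u w = (c + 1) * g u w + p * g u u + q * g u w"
      using hessian[OF mem(1) mem(2) mem(2)] by (simp add: prods g_expand g_wu algebra_simps)
    have nz: "g u u \<noteq> 0 \<or> g u w \<noteq> 0"
    proof (rule ccontr)
      assume "\<not> ?thesis"
      then have "g u y = 0" if "y \<in> H" for y
        using plane_basisD(3)[OF basis that] by (auto simp: g_expand)
      then show False using nondeg[OF mem(1)] u0 by blast
    qed
    show ?thesis
    proof (cases "c = 0")
      case c: True
      then have uu0: "g u u = 0" using hess_u by simp
      then have "(q + 1) * g u w = 0" using hess_w c by (simp add: algebra_simps)
      then have q: "q = - 1" using nz uu0 by simp
      define v where "v = (- p / 2) *\<^sub>R u + 1 *\<^sub>R w"
      have "plane_basis H u v"
        using plane_basis_change[OF basis subspace, of 1 1 0 "- p / 2"] by (simp add: v_def)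
      moreover have "v \<star> v = (p / 2) *\<^sub>R u + (- 1) *\<^sub>R w"
        unfolding v_def mult_lincomb[OF T] by (rule lincomb_cong) (simp_all add: c q)
      then have "mult_table u v 0 0 u (- v)"
        by (simp add: mult_table_def v_def mult_expand prods c)
      ultimately show ?thesis by blast
    next
      case c0: False
      then have q: "q = c" using cq by simp
      have "g u u \<noteq> 0"
      proof
        assume z: "g u u = 0"
        then have "2 * c * g u w = (c + 1) * g u w + c * g u w"
          using hess_w q by simp
        then have "g u w = 0" by (simp add: algebra_simps)
        then show False using nz z by simp
      qed
      then have "c = 2 * (c + 1)" using hess_u by simp
      then have c: "c = - 2" by simp
      define v where "v = p *\<^sub>R u + 1 *\<^sub>R w"
      have "plane_basis H u v"
        using plane_basis_change[OF basis subspace, of 1 1 0 p] by (simp add: v_def)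
      moreover have "v \<star> v = (- 2 * p) *\<^sub>R u + (- 2) *\<^sub>R w"
        unfolding v_def mult_lincomb[OF T] by (rule lincomb_cong) (simp_all add: c q)
      then have "v \<star> v = - 2 *\<^sub>R v"
        by (simp add: v_def scaleR_right_distrib)
      then have "mult_table u v 0 (- 2 *\<^sub>R u) (- u) (- 2 *\<^sub>R v)"
        by (simp add: mult_table_def) (simp add: v_def mult_expand prods c)
      ultimately show ?thesis by blast
    qed
  qed
qed

end

section \<open>The plane of an orthogonal splitting\<close>

text \<open>
  A basis of \<open>H\<close> together with its image under \<open>J\<close> is a basis of the whole space, so
  \<open>H\<close> has half the dimension.
\<close>

lemma plane_basis_of_complementary_image:
  fixes H :: "'a::real_vector set"
  assumes dim: "dim (UNIV :: 'a set) = 4" and J: "linear J" "inj J"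
    and H: "subspace H" and trivial: "H \<inter> J ` H = {0}"
    and sum: "{x + y | x y. x \<in> H \<and> y \<in> J ` H} = UNIV"
  shows "\<exists>u w. plane_basis H u w"
proof -
  obtain B where B: "B \<subseteq> H" "independent B" "H \<subseteq> span B"
    using maximal_independent_subset[of H] by blast
  have spanB: "span B = H"
    using B H by (metis span_minimal subset_antisym)
  have indJ: "independent (J ` B)"
    by (rule linear_independent_injective_image[OF J(1) B(2)])
       (rule inj_on_subset[OF J(2)], simp)
  have spanJ: "span (J ` B) = J ` H"
    using linear_span_image[OF J(1), of B] spanB by simp
  have inter0: "x = 0" if "x \<in> span B" "x \<in> span (J ` B)" for x
    using that trivial unfolding spanB spanJ by blast
  have nz: "0 \<notin> B" "0 \<notin> J ` B"
    using B(2) indJ dependent_zero by blast+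
  have disj: "B \<inter> J ` B = {}"
    using inter0 nz span_base by (metis disjoint_iff)
  have split: False
    if ab: "independent P" "independent Q" "a \<in> P" "P \<inter> Q = {}"
       "\<And>x. x \<in> span P \<Longrightarrow> x \<in> span Q \<Longrightarrow> x = 0"
       "a \<in> span (P \<union> Q - {a})" for P Q :: "'a set" and a
  proof -
    have "P \<union> Q - {a} = (P - {a}) \<union> Q" using ab(3,4) by blast
    then obtain x y where xy: "a = x + y" "x \<in> span (P - {a})" "y \<in> span Q"
      using ab(6) by (auto simp: span_Un)
    have "x \<in> span P" using xy(2) span_mono[of "P - {a}" P] by blast
    then have "y \<in> span P"
      using xy(1) span_base[OF ab(3)] span_diff[of a P x] by simp
    then have "y = 0" using ab(5) xy(3) by blast
    then show False using xy(1,2) ab(1,3) by (auto simp: dependent_def)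
  qed
  have ind: "independent (B \<union> J ` B)"
  proof
    assume "dependent (B \<union> J ` B)"
    then obtain a where a: "a \<in> B \<union> J ` B" "a \<in> span (B \<union> J ` B - {a})"
      by (auto simp: dependent_def)
    from a(1) show False
    proof
      assume "a \<in> B"
      then show False using split[OF B(2) indJ] disj inter0 a(2) by blast
    next
      assume "a \<in> J ` B"
      then show False
        using split[OF indJ B(2)] disj inter0 a(2) by (metis Int_commute Un_commute)
    qed
  qed
  have "span (B \<union> J ` B) = UNIV"
    using sum by (simp add: span_Un spanB spanJ)
  then have card: "card (B \<union> J ` B) = 4"
    using real_vector.dim_eq_card[of "B \<union> J ` B" UNIV] ind dim by simp
  then have fin: "finite B"
    by (metis card.infinite finite_Un zero_neq_numeral)
  have "card (J ` B) = card B"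
    by (rule card_image) (rule inj_on_subset[OF J(2)], simp)
  then have "card B = 2"
    using card card_Un_disjoint[OF fin _ disj] fin by simp
  then obtain u w where uw: "B = {u, w}" "u \<noteq> w"
    by (auto simp: card_2_iff)
  have "plane_basis H u w"
    unfolding plane_basis_def
  proof (intro conjI ballI allI impI)
    show "u \<in> H" "w \<in> H" using B(1) uw by auto
    show "\<exists>a b. x = a *\<^sub>R u + b *\<^sub>R w" if "x \<in> H" for x
    proof -
      have "x \<in> span {u, w}" using that spanB uw by simp
      then obtain a b where "x - a *\<^sub>R u = b *\<^sub>R w"
        by (auto simp: span_insert span_singleton)
      then have "x = a *\<^sub>R u + b *\<^sub>R w" by (simp add: algebra_simps)
      then show ?thesis by blast
    qed
    show "a = 0" "b = 0" if z: "a *\<^sub>R u + b *\<^sub>R w = 0" for a b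
    proof -
      have "(\<Sum>v\<in>{u, w}. (if v = u then a else b) *\<^sub>R v) = 0"
        using z uw(2) by simp
      then have "\<forall>v\<in>{u, w}. (if v = u then a else b) = 0"
        using real_vector.independentD[of "{u, w}" "{u, w}" "\<lambda>v. if v = u then a else b"] B(2) uw(1)
        by blast
      then show "a = 0" "b = 0" using uw(2) by auto
    qed
  qed
  then show ?thesis by blast
qed

locale orthogonal_kaehler_splitting =
  fixes br :: "'a::real_vector \<Rightarrow> 'a \<Rightarrow> 'a" and J :: "'a \<Rightarrow> 'a"
    and \<omega> :: "'a \<Rightarrow> 'a \<Rightarrow> real" and H :: "'a set"
  assumes dim4: "dim (UNIV :: 'a set) = 4"
    and kaehler: "kaehler_lie_algebra br J \<omega>"
    and ideal: "lie_ideal br H" and abelian: "lie_abelian_on br H"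
    and splitting: "orthogonal_J_splitting br J (pk_metric J \<omega>) H"
begin

lemma br: "bilinear br" "br x x = 0"
    "br x (br y z) + br y (br z x) + br z (br x y) = 0"
  using kaehler by (auto simp: kaehler_lie_algebra_def lie_bracket_def)

lemma J: "linear J" "J (J x) = - x"
    "br (J x) (J y) - br x y - J (br (J x) y) - J (br x (J y)) = 0"
  using kaehler by (auto simp: kaehler_lie_algebra_def complex_structure_def)

lemma \<omega>: "bilinear \<omega>" "\<omega> x x = 0" "(\<And>y. \<omega> x y = 0) \<Longrightarrow> x = 0"
    "\<omega> (br x y) z + \<omega> (br y z) x + \<omega> (br z x) y = 0" "\<omega> (J x) (J y) = \<omega> x y"
  using kaehler by (auto simp: kaehler_lie_algebra_def symplectic_structure_def)

lemma H: "subspace H" "y \<in> H \<Longrightarrow> br x y \<in> H" "x \<in> H \<Longrightarrow> y \<in> H \<Longrightarrow> br x y = 0"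
  using ideal abelian by (auto simp: lie_ideal_def lie_abelian_on_def)

lemma complement: "H \<inter> J ` H = {0}" "{x + y | x y. x \<in> H \<and> y \<in> J ` H} = UNIV"
  using splitting by (auto simp: orthogonal_J_splitting_def)

lemma lagrangian: "x \<in> H \<Longrightarrow> y \<in> H \<Longrightarrow> \<omega> x y = 0"
  using splitting \<omega>(5) by (auto simp: orthogonal_J_splitting_def pk_metric_def)

lemma br_antisym: "br y x = - br x y"
  by (rule bilinear_alternating_antisym[OF br(1,2)])

lemma \<omega>_antisym: "\<omega> y x = - \<omega> x y"
  by (rule bilinear_alternating_antisym[OF \<omega>(1,2)])

definition prod :: "'a \<Rightarrow> 'a \<Rightarrow> 'a" where
  "prod x y = br (J x) y"

lemma bilinear_prod: "bilinear prod"
  using br(1) J(1) unfolding bilinear_def prod_def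
  by (auto intro: linear_compose[of J, unfolded o_def])

text \<open>
  Integrability of \<open>J\<close> on the abelian ideal: the brackets on \<open>J H\<close> are those of the commutator
  of the product.
\<close>

lemma br_J_J: "x \<in> H \<Longrightarrow> y \<in> H \<Longrightarrow> br (J x) (J y) = J (prod x y - prod y x)"
  using J(3)[of x y] H(3)[of x y] br_antisym[of x "J y"]
  by (simp add: prod_def linear_diff[OF J(1)] linear_neg[OF J(1)] algebra_simps)

lemma two_dim: "\<exists>u w. plane_basis H u w"
proof (rule plane_basis_of_complementary_image[OF dim4 J(1) _ H(1) complement])
  show "inj J"
    by (rule injI) (metis J(2) neg_equal_iff_equal)
qed

sublocale plane: left_symmetric_plane H prod
proof
  show "subspace H" by (rule H(1))
  show "bilinear prod" by (rule bilinear_prod)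
  show "prod x y \<in> H" if "x \<in> H" "y \<in> H" for x y
    unfolding prod_def using that(2) by (rule H(2))
  show "prod x (prod y z) - prod y (prod x z) = prod (prod x y - prod y x) z"
    if "x \<in> H" "y \<in> H" "z \<in> H" for x y z
  proof -
    have "prod (prod x y - prod y x) z = br (br (J x) (J y)) z"
      using br_J_J[OF that(1,2)] by (simp add: prod_def)
    also have "\<dots> = br (J x) (br (J y) z) - br (J y) (br (J x) z)"
      using br(3)[of "J x" "J y" z] br_antisym[of z "J x"] br_antisym[of z "br (J x) (J y)"]
      by (simp add: bilinear_rneg[OF br(1)] algebra_simps)
    finally show ?thesis by (simp add: prod_def)
  qed
  show "\<exists>p q. plane_basis H p q" by (rule two_dim)
qed

abbreviation g :: "'a \<Rightarrow> 'a \<Rightarrow> real" where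
  "g \<equiv> pk_metric J \<omega>"

lemma bilinear_g: "bilinear g"
  using \<omega>(1) J(1) unfolding bilinear_def pk_metric_def
  by (auto intro: linear_compose[of J, unfolded o_def])

lemma g_sym: "g x y = g y x"
proof -
  have "\<omega> (J x) y = \<omega> (J (J x)) (J y)" by (simp add: \<omega>(5))
  also have "\<dots> = - \<omega> x (J y)" by (simp add: J(2) bilinear_lneg[OF \<omega>(1)])
  also have "\<dots> = \<omega> (J y) x" using \<omega>_antisym[of x "J y"] by simp
  finally show ?thesis by (simp add: pk_metric_def)
qed

text \<open>
  This is closedness of \<open>\<omega>\<close> on a triple \<open>J x, J y, z\<close>.
\<close>

lemma hessian:
  assumes "x \<in> H" "y \<in> H" "z \<in> H"
  shows "g (prod x y) z + g y (prod x z) = g (prod y x) z + g x (prod y z)"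
proof -
  have "\<omega> (J (prod x y) - J (prod y x)) z + \<omega> (br (J y) z) (J x) + \<omega> (br z (J x)) (J y) = 0"
    using \<omega>(4)[of "J x" "J y" z] br_J_J[OF assms(1,2)] by (simp add: linear_diff[OF J(1)])
  moreover have "\<omega> (br (J y) z) (J x) = - g x (prod y z)"
    using \<omega>_antisym[of "br (J y) z" "J x"] by (simp add: pk_metric_def prod_def)
  moreover have "\<omega> (br z (J x)) (J y) = g y (prod x z)"
    using \<omega>_antisym[of "br z (J x)" "J y"] br_antisym[of z "J x"]
    by (simp add: pk_metric_def prod_def bilinear_rneg[OF \<omega>(1)])
  ultimately show ?thesis
    by (simp add: pk_metric_def bilinear_lsub[OF \<omega>(1)])
qed

lemma g_nondegenerate:
  assumes x: "x \<in> H" and orth: "\<And>y. y \<in> H \<Longrightarrow> g x y = 0"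
  shows "x = 0"
proof -
  have "\<omega> (J x) z = 0" for z
  proof -
    obtain y y' where "z = y + J y'" "y \<in> H" "y' \<in> H"
      using complement(2) by blast
    then show ?thesis
      using orth lagrangian[OF x] by (simp add: bilinear_radd[OF \<omega>(1)] \<omega>(5) pk_metric_def)
  qed
  then have "J x = 0" by (rule \<omega>(3))
  then show "x = 0" using J(2)[of x] linear_0[OF J(1)] by simp
qed

lemma frame_independent:
  assumes uw: "plane_basis H u w"
    and zero: "a *\<^sub>R u + b *\<^sub>R w + c *\<^sub>R J u + d *\<^sub>R J w = 0"
  shows "a = 0 \<and> b = 0 \<and> c = 0 \<and> d = 0"
proof -
  let ?x = "a *\<^sub>R u + b *\<^sub>R w" and ?y = "c *\<^sub>R u + d *\<^sub>R w"
  have mem: "- ?x \<in> H" "?y \<in> H"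
    using plane_basisD(1,2)[OF uw] H(1) by (simp_all add: subspace_add subspace_diff subspace_scale subspace_neg)
  have "?x + J ?y = 0"
    using zero by (simp add: linear_add[OF J(1)] linear_cmul[OF J(1)] add.assoc)
  then have eq: "- ?x = J ?y" by (rule minus_unique)
  then have "- ?x \<in> H \<inter> J ` H" using mem by blast
  then have "- ?x = 0" using complement(1) by blast
  then have x0: "?x = 0" by (simp only: neg_equal_0_iff_equal)
  then have "J ?y = 0" using eq by simp
  then have y0: "?y = 0"
    using J(2)[of ?y] linear_0[OF J(1)] by (metis neg_equal_0_iff_equal)
  show ?thesis
    using plane_basisD(4)[OF uw x0] plane_basisD(4)[OF uw y0] by blast
qed

text \<open>
  The frame \<open>u, w, J u, J w\<close> and its brackets; the isomorphisms below only permute and rescale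
  this frame.
\<close>

lemma frame_brackets:
  assumes uw: "plane_basis H u w" and table: "plane.mult_table u w uu uw wu ww"
  shows "br (J u) u = uu" "br (J u) w = uw" "br (J w) u = wu" "br (J w) w = ww"
    "br u (J u) = - uu" "br w (J u) = - uw" "br u (J w) = - wu" "br w (J w) = - ww"
    "br u w = 0" "br w u = 0" "br (J u) (J w) = J uw - J wu" "br (J w) (J u) = J wu - J uw"
proof -
  note mem = plane_basisD(1,2)[OF uw]
  show prods: "br (J u) u = uu" "br (J u) w = uw" "br (J w) u = wu" "br (J w) w = ww"
    using table by (simp_all add: plane.mult_table_def prod_def)
  show "br u (J u) = - uu" "br w (J u) = - uw" "br u (J w) = - wu" "br w (J w) = - ww"
    using prods br_antisym by metis+
  show "br u w = 0" "br w u = 0"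
    using H(3) mem by blast+
  show "br (J u) (J w) = J uw - J wu" "br (J w) (J u) = J wu - J uw"
    using br_J_J[of u w] br_J_J[of w u] mem prods
    by (simp_all add: prod_def linear_diff[OF J(1)])
qed

lemmas lie_isomorphicI = lie_isomorphic_by_frame[OF dim4 br(1,2)]

lemmas model_eval = frame_map_def model_br_defs wedge_def axis_def
  bilinear_expand[OF br(1)] linear_0[OF J(1)] linear_neg[OF J(1)] linear_cmul[OF J(1)]

lemma iso_R4:
  assumes uw: "plane_basis H u w" and table: "plane.mult_table u w 0 0 0 0"
  shows "lie_isomorphic br R4_br"
proof (rule lie_isomorphicI[of R4_br u w "J u" "J w"])
  show "a = 0 \<and> b = 0 \<and> c = 0 \<and> d = 0"
    if "a *\<^sub>R u + b *\<^sub>R w + c *\<^sub>R J u + d *\<^sub>R J w = 0" for a b c d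
    using frame_independent[OF uw that] .
qed (simp_all add: model_bilinear model_alternating frame_brackets[OF uw table] model_eval)

lemma iso_R_h3:
  assumes uw: "plane_basis H u w" and table: "plane.mult_table u w w 0 0 0"
  shows "lie_isomorphic br R_h3_br"
proof (rule lie_isomorphicI[of R_h3_br "J u" u w "J w"])
  show "a = 0 \<and> b = 0 \<and> c = 0 \<and> d = 0"
    if "a *\<^sub>R J u + b *\<^sub>R u + c *\<^sub>R w + d *\<^sub>R J w = 0" for a b c d
    using frame_independent[OF uw, of b c a d] that by (simp add: add_ac)
qed (simp_all add: model_bilinear model_alternating frame_brackets[OF uw table] model_eval)

lemma iso_R2_affR:
  assumes uw: "plane_basis H u w" and table: "plane.mult_table u w u 0 0 0"
  shows "lie_isomorphic br R2_affR_br"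
proof (rule lie_isomorphicI[of R2_affR_br "J u" u w "J w"])
  show "a = 0 \<and> b = 0 \<and> c = 0 \<and> d = 0"
    if "a *\<^sub>R J u + b *\<^sub>R u + c *\<^sub>R w + d *\<^sub>R J w = 0" for a b c d
    using frame_independent[OF uw, of b c a d] that by (simp add: add_ac)
qed (simp_all add: model_bilinear model_alternating frame_brackets[OF uw table] model_eval)

lemma iso_affC:
  assumes uw: "plane_basis H u w" and table: "plane.mult_table u w u w w (- u)"
  shows "lie_isomorphic br affC_br"
proof (rule lie_isomorphicI[of affC_br "J u" "J w" u w])
  show "a = 0 \<and> b = 0 \<and> c = 0 \<and> d = 0"
    if "a *\<^sub>R J u + b *\<^sub>R J w + c *\<^sub>R u + d *\<^sub>R w = 0" for a b c d
    using frame_independent[OF uw, of c d a b] that by (simp add: add_ac)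
qed (simp_all add: model_bilinear model_alternating frame_brackets[OF uw table] model_eval)

lemma iso_affR_affR:
  assumes uw: "plane_basis H u w" and table: "plane.mult_table u w u 0 0 w"
  shows "lie_isomorphic br affR_affR_br"
proof (rule lie_isomorphicI[of affR_affR_br "J u" u "J w" w])
  show "a = 0 \<and> b = 0 \<and> c = 0 \<and> d = 0"
    if "a *\<^sub>R J u + b *\<^sub>R u + c *\<^sub>R J w + d *\<^sub>R w = 0" for a b c d
    using frame_independent[OF uw, of b d a c] that by (simp add: add_ac)
qed (simp_all add: model_bilinear model_alternating frame_brackets[OF uw table] model_eval)

lemma iso_d4_1:
  assumes uw: "plane_basis H u w" and table: "plane.mult_table u w u w w 0"
  shows "lie_isomorphic br (d4_br 1)"
proof (rule lie_isomorphicI[of "d4_br 1" u "- J w" w "J u"])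
  show "a = 0 \<and> b = 0 \<and> c = 0 \<and> d = 0"
    if "a *\<^sub>R u + b *\<^sub>R (- J w) + c *\<^sub>R w + d *\<^sub>R J u = 0" for a b c d
    using frame_independent[OF uw, of a c d "- b"] that by (simp add: algebra_simps)
qed (simp_all add: model_bilinear model_alternating frame_brackets[OF uw table] model_eval)

lemma iso_r4_m1_m1:
  assumes uw: "plane_basis H u w" and table: "plane.mult_table u w 0 0 u (- w)"
  shows "lie_isomorphic br r4_m1_m1_br"
proof (rule lie_isomorphicI[of r4_m1_m1_br w u "J u" "- J w"])
  show "a = 0 \<and> b = 0 \<and> c = 0 \<and> d = 0"
    if "a *\<^sub>R w + b *\<^sub>R u + c *\<^sub>R J u + d *\<^sub>R (- J w) = 0" for a b c d
    using frame_independent[OF uw, of b a c "- d"] that by (simp add: algebra_simps)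
qed (simp_all add: model_bilinear model_alternating frame_brackets[OF uw table] model_eval)

lemma iso_d4_2:
  assumes uw: "plane_basis H u w"
    and table: "plane.mult_table u w 0 (-2 *\<^sub>R u) (- u) (-2 *\<^sub>R w)"
  shows "lie_isomorphic br (d4_br 2)"
proof (rule lie_isomorphicI[of "d4_br 2" w "J u" "2 *\<^sub>R u" "- J w"])
  show "a = 0 \<and> b = 0 \<and> c = 0 \<and> d = 0"
    if "a *\<^sub>R w + b *\<^sub>R J u + c *\<^sub>R (2 *\<^sub>R u) + d *\<^sub>R (- J w) = 0" for a b c d
    using frame_independent[OF uw, of "2 * c" a b "- d"] that by (simp add: algebra_simps)
qed (simp_all add: model_bilinear model_alternating frame_brackets[OF uw table] model_eval scaleR_2[of "J u"])

text \<open>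
  The sign of \<open>b\<close> distinguishes two left-symmetric products, but not two Lie algebras: \<open>b\<close> is
  absorbed into the central direction \<open>[u, J u] = - b w\<close> of the Heisenberg ideal.
\<close>

lemma iso_d4_half:
  assumes uw: "plane_basis H u w" and b: "b \<noteq> 0"
    and table: "plane.mult_table u w (b *\<^sub>R w) 0 u (2 *\<^sub>R w)"
  shows "lie_isomorphic br (d4_br (1/2))"
proof (rule lie_isomorphicI[of "d4_br (1/2)" u "J u" "(- b) *\<^sub>R w" "(1/2) *\<^sub>R J w"])
  show "x = 0 \<and> y = 0 \<and> z = 0 \<and> t = 0"
    if "x *\<^sub>R u + y *\<^sub>R J u + z *\<^sub>R ((- b) *\<^sub>R w) + t *\<^sub>R ((1/2) *\<^sub>R J w) = 0" for x y z t
    using frame_independent[OF uw, of x "- (z * b)" y "t / 2"] that b by (simp add: algebra_simps)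
qed (simp_all add: model_bilinear model_alternating frame_brackets[OF uw table] model_eval)

lemma classification:
  "lie_isomorphic br R4_br \<or> lie_isomorphic br R_h3_br \<or> lie_isomorphic br R2_affR_br \<or>
   lie_isomorphic br affC_br \<or> lie_isomorphic br affR_affR_br \<or>
   lie_isomorphic br r4_m1_m1_br \<or> lie_isomorphic br (d4_br 1) \<or>
   lie_isomorphic br (d4_br 2) \<or> lie_isomorphic br (d4_br (1/2))"
proof (cases "\<exists>x\<in>H. \<exists>y\<in>H. prod x y \<noteq> prod y x")
  case True
  from plane.noncommutative_plane_cases[OF True bilinear_g g_sym hessian g_nondegenerate]
  obtain u w b where uw: "plane_basis H u w" and
    "plane.mult_table u w 0 0 u (- w) \<or>
     plane.mult_table u w 0 (-2 *\<^sub>R u) (- u) (-2 *\<^sub>R w) \<or>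
     b \<noteq> 0 \<and> plane.mult_table u w (b *\<^sub>R w) 0 u (2 *\<^sub>R w)"
    by blast
  then show ?thesis
    using iso_r4_m1_m1[OF uw] iso_d4_2[OF uw] iso_d4_half[OF uw, of b] by argo
next
  case False
  then have "prod x y = prod y x" if "x \<in> H" "y \<in> H" for x y
    using that by blast
  from plane.commutative_plane_cases[OF this]
  show ?thesis
    using iso_R4 iso_R_h3 iso_R2_affR iso_d4_1 iso_affC iso_affR_affR by blast
qed

end

theorem proposition3p1:
  fixes br :: "'a::real_vector \<Rightarrow> 'a \<Rightarrow> 'a"
    and J :: "'a \<Rightarrow> 'a"
    and \<omega> :: "'a \<Rightarrow> 'a \<Rightarrow> real"
  assumes "dim (UNIV :: 'a set) = 4"
    and "kaehler_lie_algebra br J \<omega>"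
    and "\<exists>\<hh>. lie_ideal br \<hh> \<and> lie_abelian_on br \<hh> \<and>
           orthogonal_J_splitting br J (pk_metric J \<omega>) \<hh>"
  shows "lie_isomorphic br R4_br \<or>
         lie_isomorphic br R_h3_br \<or>
         lie_isomorphic br R2_affR_br \<or>
         lie_isomorphic br affC_br \<or>
         lie_isomorphic br affR_affR_br \<or>
         lie_isomorphic br r4_m1_m1_br \<or>
         lie_isomorphic br (d4_br 1) \<or>
         lie_isomorphic br (d4_br 2) \<or>
         lie_isomorphic br (d4_br (1/2))"
proof -
  obtain \<hh> where "lie_ideal br \<hh>" "lie_abelian_on br \<hh>"
    "orthogonal_J_splitting br J (pk_metric J \<omega>) \<hh>"
    using assms(3) by blast
  then interpret orthogonal_kaehler_splitting br J \<omega> \<hh>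
    using assms(1,2) by unfold_locales
  show ?thesis by (rule classification)
qed

end
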